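(* Let $k\ge 1$ and let $n\ge 3$ with $n\ge 2k-1$. Every min-saturated convex precolored $\Theta^k$-drawing of a graph on $n$ vertices contains at least $$\frac{k(n-2k+1)}{2k-3}+n$$ edges.
   Context: Graphs are finite and simple. In a straight-line drawing, vertices are distinct points of the plane in general position (no three on a line) and edges are straight-line segments; two edges cross if their relative interiors share a point. A $\Theta^k$-drawing of a graph $G$ is a straight-line drawing $\Gamma$ of $G$ for which there exists an edge-coloring $\varphi\colon E(G)\to\{1,\dots,k\}$ such that no two edges of the same color cross. (Not all colors need to be used.) A precolored $\Theta^k$-drawing is a $\Theta^k$-drawing together with a fixed such coloring $\varphi$. The drawing is convex if its vertices are in convex position. A precolored $\Theta^k$-drawing $\Gamma$ with coloring $\varphi$ is saturated if there are no two distinct vertices $u,v$ with $uv\notin E(G)$ and no color $i\in\{1,\dots,k\}$ such that adding the straight-line edge $uv$ with color $i$ to $\Gamma$ (keeping the colors of all other edges) yields a drawing without monochromatic crossings. A saturated convex precolored $\Theta^k$-drawing is min-saturated if it has the minimum number of edges among all saturated convex precolored $\Theta^k$-drawings on the same number of vertices. *)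

theory Defs
  imports "HOL-Analysis.Analysis"
begin

definition simple_graph :: "'a set \<Rightarrow> 'a set set \<Rightarrow> bool" where
  "simple_graph V E \<longleftrightarrow> finite V \<and> (\<forall>e\<in>E. e \<subseteq> V \<and> card e = 2)"

definition general_position :: "(real ^ 2) set \<Rightarrow> bool" where
  "general_position S \<longleftrightarrow>
     (\<forall>a\<in>S. \<forall>b\<in>S. \<forall>c\<in>S. a \<noteq> b \<and> b \<noteq> c \<and> a \<noteq> c \<longrightarrow> \<not> collinear {a, b, c})"

definition convex_position :: "(real ^ 2) set \<Rightarrow> bool" where
  "convex_position S \<longleftrightarrow> (\<forall>x\<in>S. x \<notin> convex hull (S - {x}))"

text \<open>A straight-line drawing of the graph \<open>(V, E)\<close> is determined by the placement \<open>p\<close> of its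
  vertices; only the values of \<open>p\<close> on \<open>V\<close> matter.\<close>

definition straight_line_drawing :: "'a set \<Rightarrow> 'a set set \<Rightarrow> ('a \<Rightarrow> real ^ 2) \<Rightarrow> bool" where
  "straight_line_drawing V E p \<longleftrightarrow>
     simple_graph V E \<and> inj_on p V \<and> general_position (p ` V)"

text \<open>For \<open>e = {u, v}\<close> this is the closed segment between \<open>p u\<close> and \<open>p v\<close>.\<close>

definition edge_segment :: "('a \<Rightarrow> real ^ 2) \<Rightarrow> 'a set \<Rightarrow> (real ^ 2) set" where
  "edge_segment p e = convex hull (p ` e)"

definition crosses :: "('a \<Rightarrow> real ^ 2) \<Rightarrow> 'a set \<Rightarrow> 'a set \<Rightarrow> bool" where
  "crosses p e f \<longleftrightarrow> rel_interior (edge_segment p e) \<inter> rel_interior (edge_segment p f) \<noteq> {}"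

definition theta_coloring ::
  "nat \<Rightarrow> 'a set set \<Rightarrow> ('a \<Rightarrow> real ^ 2) \<Rightarrow> ('a set \<Rightarrow> nat) \<Rightarrow> bool" where
  "theta_coloring k E p \<phi> \<longleftrightarrow>
     \<phi> ` E \<subseteq> {1..k} \<and>
     (\<forall>e\<in>E. \<forall>f\<in>E. e \<noteq> f \<and> \<phi> e = \<phi> f \<longrightarrow> \<not> crosses p e f)"

definition theta_drawing :: "nat \<Rightarrow> 'a set \<Rightarrow> 'a set set \<Rightarrow> ('a \<Rightarrow> real ^ 2) \<Rightarrow> bool" where
  "theta_drawing k V E p \<longleftrightarrow> straight_line_drawing V E p \<and> (\<exists>\<phi>. theta_coloring k E p \<phi>)"

definition precolored_theta_drawing ::
  "nat \<Rightarrow> 'a set \<Rightarrow> 'a set set \<Rightarrow> ('a \<Rightarrow> real ^ 2) \<Rightarrow> ('a set \<Rightarrow> nat) \<Rightarrow> bool" where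
  "precolored_theta_drawing k V E p \<phi> \<longleftrightarrow> theta_drawing k V E p \<and> theta_coloring k E p \<phi>"

definition saturated ::
  "nat \<Rightarrow> 'a set \<Rightarrow> 'a set set \<Rightarrow> ('a \<Rightarrow> real ^ 2) \<Rightarrow> ('a set \<Rightarrow> nat) \<Rightarrow> bool" where
  "saturated k V E p \<phi> \<longleftrightarrow>
     precolored_theta_drawing k V E p \<phi> \<and>
     \<not> (\<exists>u\<in>V. \<exists>v\<in>V. \<exists>i\<in>{1..k}. u \<noteq> v \<and> {u, v} \<notin> E \<and>
          precolored_theta_drawing k V (insert {u, v} E) p (\<phi>({u, v} := i)))"

definition saturated_convex ::
  "nat \<Rightarrow> 'a set \<Rightarrow> 'a set set \<Rightarrow> ('a \<Rightarrow> real ^ 2) \<Rightarrow> ('a set \<Rightarrow> nat) \<Rightarrow> bool" where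
  "saturated_convex k V E p \<phi> \<longleftrightarrow> saturated k V E p \<phi> \<and> convex_position (p ` V)"

text \<open>Letting the competitors range over graphs with vertices in the same type is no restriction:
  every drawing on \<open>card V\<close> vertices can be relabelled to have vertex set \<open>V\<close>.\<close>

definition min_saturated ::
  "nat \<Rightarrow> 'a set \<Rightarrow> 'a set set \<Rightarrow> ('a \<Rightarrow> real ^ 2) \<Rightarrow> ('a set \<Rightarrow> nat) \<Rightarrow> bool" where
  "min_saturated k V E p \<phi> \<longleftrightarrow>
     saturated_convex k V E p \<phi> \<and>
     (\<forall>(V' :: 'a set) E' p' \<phi>'.
        saturated_convex k V' E' p' \<phi>' \<and> card V' = card V \<longrightarrow> card E \<le> card E')"

end

theory Submission
  imports Defs
begin

text \<open>Order the vertices along the convex hull, so that two edges cross iff their endpoints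
  interleave. Fix a colour and consider a cell, with \<open>m\<close> vertices, into which its diagonals
  cut the polygon. By saturation all \<open>m (m - 3) / 2\<close> diagonals of the cell are edges of the other
  \<open>k - 1\<close> colours, each of which supplies at most \<open>m - 3\<close> of them; hence \<open>m < 2 k\<close> if \<open>k \<ge> 2\<close>.
  Since \<open>d\<close> diagonals leave \<open>d + 1\<close> cells and the values \<open>m - 2\<close> sum to \<open>n - 2\<close>, each colour has at
  least \<open>(n - 2) / (2 k - 3) - 1\<close> diagonals. The \<open>n\<close> hull edges are all present, because nothing
  crosses them.\<close>

section \<open>Noncrossing diagonals of a polygon\<close>

text \<open>Combinatorial form of crossing, for points labelled in hull order and chords written
  with the smaller label first. Strictness makes chords with a common endpoint
  non-interleaved.\<close>

fun interleaved :: "'a::linorder \<times> 'a \<Rightarrow> 'a \<times> 'a \<Rightarrow> bool" where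
  "interleaved (a, b) (c, d) \<longleftrightarrow> a < c \<and> c < b \<and> b < d \<or> c < a \<and> a < d \<and> d < b"

definition noncrossing :: "('a::linorder \<times> 'a) set \<Rightarrow> bool" where
  "noncrossing F \<longleftrightarrow> (\<forall>e\<in>F. \<forall>f\<in>F. \<not> interleaved e f)"

definition chords :: "'a::linorder set \<Rightarrow> ('a \<times> 'a) set" where
  "chords S = {(a, b). a \<in> S \<and> b \<in> S \<and> a < b}"

text \<open>Any finite \<open>S\<close> serves as a polygon with its points in increasing order; a
  diagonal has further points of \<open>S\<close> on both sides. The notion is relative: a side of a
  sub-polygon may be a diagonal of the whole.\<close>

definition diagonals :: "'a::linorder set \<Rightarrow> ('a \<times> 'a) set" where
  "diagonals S = {(a, b) \<in> chords S. (\<exists>x\<in>S. a < x \<and> x < b) \<and> (\<exists>x\<in>S. x < a \<or> b < x)}"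

lemma noncrossing_subset: "noncrossing F \<Longrightarrow> G \<subseteq> F \<Longrightarrow> noncrossing G"
  by (auto simp: noncrossing_def)

lemma finite_chords: "finite S \<Longrightarrow> finite (chords S)"
  by (rule finite_subset[of _ "S \<times> S"]) (auto simp: chords_def)

lemma finite_diagonals: "finite S \<Longrightarrow> finite (diagonals S)"
  by (rule finite_subset[OF _ finite_chords[of S]]) (auto simp: diagonals_def)

lemma diagonals_mono: "T \<subseteq> S \<Longrightarrow> diagonals T \<subseteq> diagonals S"
  by (fastforce simp: diagonals_def chords_def)

text \<open>The endpoints of each chord witness that the other has points on both sides. Hence sides
  of the polygon interleave with no chord.\<close>

lemma interleaved_chords_diagonals:
  assumes "e \<in> chords S" "f \<in> chords S" "interleaved e f"
  shows "e \<in> diagonals S" "f \<in> diagonals S"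
  using assms by (auto simp: diagonals_def chords_def)

section \<open>Counting chords, sides and diagonals\<close>

lemma card_chords: "finite S \<Longrightarrow> 2 * card (chords S) = card S * (card S - 1)"
proof (induction "card S" arbitrary: S)
  case 0
  then show ?case by (auto simp: chords_def)
next
  case (Suc m)
  define M where "M = Max S"
  define T where "T = S - {M}"
  have ne: "S \<noteq> {}" using Suc.hyps(2) by auto
  then have M: "M \<in> S" "\<And>x. x \<in> S \<Longrightarrow> x \<le> M"
    using Suc.prems by (auto simp: M_def)
  have cT: "card T = m" "finite T" using M Suc by (auto simp: T_def)
  have "chords S = chords T \<union> T \<times> {M}"
    using M by (force simp: chords_def T_def)
  moreover have "chords T \<inter> T \<times> {M} = {}"
    by (auto simp: chords_def T_def)
  ultimately have "card (chords S) = card (chords T) + m"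
    using cT by (simp add: card_Un_disjoint finite_chords)
  moreover have "2 * card (chords T) = m * (m - 1)"
    using Suc.hyps(1)[of T] cT by simp
  ultimately show ?case unfolding Suc.hyps(2)[symmetric]
    by (cases m) (auto simp: algebra_simps)
qed

lemma card_boundary_chords_le:
  assumes "finite S"
  shows "card (chords S - diagonals S) \<le> card S"
proof (rule card_inj_on_le[OF _ _ assms])
  \<comment> \<open>every boundary chord joins consecutive points, except the one from \<open>Min S\<close> to \<open>Max S\<close>\<close>
  define g where "g = (\<lambda>(a, b). if \<exists>x\<in>S. a < x \<and> x < b then Max S else a)"
  have outer: "a = Min S \<and> b = Max S"
    if "(a, b) \<in> chords S - diagonals S" "\<exists>x\<in>S. a < x \<and> x < b" for a b
  proof -
    have *: "a \<le> x \<and> x \<le> b" if "x \<in> S" for x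
      using that \<open>(a, b) \<in> _\<close> \<open>\<exists>x\<in>S. a < x \<and> x < b\<close>
      by (auto simp: chords_def diagonals_def not_less)
    have "a \<in> S" "b \<in> S" using that by (auto simp: chords_def)
    with * show ?thesis using assms by (metis Max_eqI Min_eqI)
  qed
  have not_max: "a \<noteq> Max S" if "(a, b) \<in> chords S" for a b
    using that assms by (metis (no_types, lifting) Max_ge case_prodD chords_def leD mem_Collect_eq)
  show "inj_on g (chords S - diagonals S)"
  proof (rule inj_onI, clarsimp)
    fix a b c d
    assume *: "(a, b) \<in> chords S" "(a, b) \<notin> diagonals S"
      "(c, d) \<in> chords S" "(c, d) \<notin> diagonals S" "g (a, b) = g (c, d)"
    show "a = c \<and> b = d"
    proof (cases "\<exists>x\<in>S. a < x \<and> x < b")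
      case True
      then have "\<exists>x\<in>S. c < x \<and> x < d"
        using * not_max[of c d] by (auto simp: g_def split: if_splits)
      then show ?thesis using outer[of a b] outer[of c d] * True by simp
    next
      case False
      then have F: "\<not> (\<exists>x\<in>S. c < x \<and> x < d)" and "a = c"
        using * not_max[of a b] by (auto simp: g_def split: if_splits)
      moreover have "b \<in> S" "d \<in> S" "a < b" "c < d" using * by (auto simp: chords_def)
      ultimately show ?thesis using False by (metis linorder_neqE)
    qed
  qed
  show "g ` (chords S - diagonals S) \<subseteq> S"
    using assms by (auto simp: g_def chords_def intro!: Max_in)
qed

text \<open>This supplies the \<open>n\<close> hull edges of the final bound. From
  \<open>n \<ge> 3\<close> on, the closing side \<open>(0, n - 1)\<close> differs from every
  \<open>(i, Suc i)\<close>.\<close>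

lemma card_boundary_chords_lessThan:
  assumes "n \<ge> 3"
  shows "n \<le> card (chords {..<n} - diagonals {..<n})"
proof -
  define g where "g = (\<lambda>i. if i = n - 1 then (0, n - 1) else (i, Suc i))"
  have "inj_on g {..<n}"
    using assms by (auto simp: inj_on_def g_def split: if_splits)
  moreover have "g ` {..<n} \<subseteq> chords {..<n} - diagonals {..<n}"
    using assms by (auto simp: g_def chords_def diagonals_def)
  ultimately have "card {..<n} \<le> card (chords {..<n} - diagonals {..<n})"
    by (intro card_inj_on_le) (auto simp: finite_chords)
  then show ?thesis by simp
qed

text \<open>All chords minus at most \<open>card S\<close> sides. For fewer than three points the
  truncated left-hand side is zero.\<close>

lemma card_diagonals_ge:
  assumes "finite S"
  shows "card S * (card S - 3) \<le> 2 * card (diagonals S)"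
proof -
  have "diagonals S \<subseteq> chords S" by (auto simp: diagonals_def)
  then have "card (chords S) = card (diagonals S) + card (chords S - diagonals S)"
    using card_Diff_subset[OF finite_diagonals] card_mono[OF finite_chords] assms
    by (metis le_add_diff_inverse)
  then have "card S * (card S - 1) \<le> 2 * card (diagonals S) + 2 * card S"
    using card_chords[OF assms] card_boundary_chords_le[OF assms] by simp
  moreover have "card S * (card S - 3) = card S * (card S - 1) - 2 * card S"
    by (simp add: diff_mult_distrib2 mult.commute)
  ultimately show ?thesis by simp
qed

section \<open>Cutting a polygon along a diagonal\<close>

text \<open>Both pieces keep \<open>a\<close> and \<open>b\<close>, whence the \<open>+ 2\<close>.
  Any other member of \<open>F\<close> stays on one side of the cut and remains a diagonal of that
  piece, while \<open>(a, b)\<close> becomes a side of both.\<close>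

lemma diagonal_split:
  fixes S :: "'a::linorder set"
  assumes "finite S" "F \<subseteq> diagonals S" "noncrossing F" "(a, b) \<in> F"
  defines "S1 \<equiv> S \<inter> {a..b}" and "S2 \<equiv> S - {a<..<b}"
  shows "card S1 + card S2 = card S + 2" "card S1 \<ge> 3" "card S2 \<ge> 3"
    and "F = insert (a, b) (F \<inter> diagonals S1 \<union> F \<inter> diagonals S2)"
    and "card F = card (F \<inter> diagonals S1) + card (F \<inter> diagonals S2) + 1"
proof -
  have ab: "a \<in> S" "b \<in> S" "a < b" using assms by (auto simp: diagonals_def chords_def)
  obtain x y where x: "x \<in> S" "a < x" "x < b" and y: "y \<in> S" "y < a \<or> b < y"
    using assms by (auto simp: diagonals_def)
  have fin: "finite S1" "finite S2" "finite F"
    using assms(1) finite_subset[OF assms(2) finite_diagonals] by (auto simp: S1_def S2_def)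
  have "S1 \<union> S2 = S" "S1 \<inter> S2 = {a, b}" using ab by (auto simp: S1_def S2_def)
  then show "card S1 + card S2 = card S + 2"
    using card_Un_Int[OF fin(1,2)] ab by simp
  have "{a, x, b} \<subseteq> S1" using x ab by (auto simp: S1_def)
  moreover have "card {a, x, b} = 3" using x ab by (simp add: order.strict_implies_not_eq)
  ultimately show "card S1 \<ge> 3" using card_mono[OF fin(1)] by metis
  have "{a, b, y} \<subseteq> S2" using y ab by (auto simp: S2_def)
  moreover have "card {a, b, y} = 3" using y ab by (auto simp: card_insert_if)
  ultimately show "card S2 \<ge> 3" using card_mono[OF fin(2)] by metis
  have "(c, d) \<in> diagonals S1 \<union> diagonals S2" if cd: "(c, d) \<in> F" "(c, d) \<noteq> (a, b)" for c d
  proof -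
    have d: "(c, d) \<in> diagonals S" and n: "\<not> interleaved (a, b) (c, d)"
      using cd assms(2-4) unfolding noncrossing_def by blast+
    then obtain u v where u: "u \<in> S" "c < u" "u < d" and v: "v \<in> S" "v < c \<or> d < v"
      by (auto simp: diagonals_def)
    have cdS: "c \<in> S" "d \<in> S" "c < d" using d by (auto simp: diagonals_def chords_def)
    \<comment> \<open>A chord that does not interleave with \<open>(a, b)\<close> lies within it,
      around it, before it or after it. In each case \<open>a\<close> or \<open>b\<close> replaces
      the witness that may have been cut away.\<close>
    consider "a \<le> c" "d \<le> b" | "c \<le> a" "b \<le> d" | "d \<le> a" | "b \<le> c"
      using n cdS ab by fastforce
    then show ?thesis
    proof cases
      case 1
      then have "c \<in> S1" "d \<in> S1" "u \<in> S1" "a \<in> S1" "b \<in> S1"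
        using cdS u ab by (auto simp: S1_def)
      moreover have "a < c \<or> d < b" using 1 cd(2) by auto
      ultimately have "(c, d) \<in> diagonals S1"
        using cdS u unfolding diagonals_def chords_def by blast
      then show ?thesis ..
    next
      case 2
      then have "v \<in> S2" "a \<in> S2" "b \<in> S2" "c \<in> S2" "d \<in> S2"
        using cdS v ab by (auto simp: S2_def)
      moreover have "c < a \<and> a < d \<or> c < b \<and> b < d" using 2 cd(2) ab by auto
      ultimately have "(c, d) \<in> diagonals S2"
        using cdS v unfolding diagonals_def chords_def by blast
      then show ?thesis ..
    next
      case 3
      then have "b \<in> S2" "u \<in> S2" "c \<in> S2" "d \<in> S2" "d < b"
        using cdS u ab by (auto simp: S2_def)
      then have "(c, d) \<in> diagonals S2"
        using cdS u by (auto simp: diagonals_def chords_def)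
      then show ?thesis ..
    next
      case 4
      then have "a \<in> S2" "u \<in> S2" "c \<in> S2" "d \<in> S2" "a < c"
        using cdS u ab by (auto simp: S2_def)
      then have "(c, d) \<in> diagonals S2"
        using cdS u by (auto simp: diagonals_def chords_def)
      then show ?thesis ..
    qed
  qed
  then show F: "F = insert (a, b) (F \<inter> diagonals S1 \<union> F \<inter> diagonals S2)"
    using assms(4) by auto
  have n: "(a, b) \<notin> diagonals S1" "(a, b) \<notin> diagonals S2"
    by (auto simp: diagonals_def S1_def S2_def)
  have "diagonals S1 \<inter> diagonals S2 \<subseteq> {(a, b)}"
    by (auto simp: diagonals_def chords_def S1_def S2_def)
  then have "(F \<inter> diagonals S1) \<inter> (F \<inter> diagonals S2) = {}" using n by auto
  then have "card (F \<inter> diagonals S1 \<union> F \<inter> diagonals S2)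
      = card (F \<inter> diagonals S1) + card (F \<inter> diagonals S2)"
    using fin by (intro card_Un_disjoint) auto
  moreover have "card F = Suc (card (F \<inter> diagonals S1 \<union> F \<inter> diagonals S2))"
    by (subst F, subst card_insert_disjoint) (use n fin in auto)
  ultimately show "card F = card (F \<inter> diagonals S1) + card (F \<inter> diagonals S2) + 1"
    by simp
qed

text \<open>Induction by cutting: \<open>(card S1 - 3) + (card S2 - 3) + 1 = card S - 3\<close>.
  Triangulations attain the bound.\<close>

lemma card_noncrossing_diagonals_le:
  fixes S :: "'a::linorder set"
  assumes "finite S" "F \<subseteq> diagonals S" "noncrossing F" "card S \<ge> 3"
  shows "card F + 3 \<le> card S"
  using assms
proof (induction "card F" arbitrary: F S rule: less_induct)
  case less
  show ?case
  proof (cases "F = {}")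
    case True
    then show ?thesis using less by simp
  next
    case False
    then obtain a b where ab: "(a, b) \<in> F" by auto
    define S1 S2 where "S1 = S \<inter> {a..b}" and "S2 = S - {a<..<b}"
    note * = diagonal_split[OF less.prems(1-3) ab, folded S1_def S2_def]
    have fin: "finite S1" "finite S2" using less.prems by (auto simp: S1_def S2_def)
    have "card (F \<inter> diagonals S1) + 3 \<le> card S1"
      using * fin less.prems(3) by (intro less.hyps) (auto intro: noncrossing_subset)
    moreover have "card (F \<inter> diagonals S2) + 3 \<le> card S2"
      using * fin less.prems(3) by (intro less.hyps) (auto intro: noncrossing_subset)
    ultimately show ?thesis using *(1,5) by linarith
  qed
qed

text \<open>Pigeonhole over the \<open>card F + 1\<close> cells, without defining cells: both
  \<open>card F + 1\<close> and \<open>card S - 2\<close> are additive under a cut, so one piece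
  inherits the size hypothesis, and the descent ends in a cell \<open>T\<close>.\<close>

lemma noncrossing_large_face:
  fixes S :: "'a::linorder set"
  assumes "finite S" "F \<subseteq> diagonals S" "noncrossing F" "(card F + 1) * m + 2 < card S"
  shows "\<exists>T\<subseteq>S. m + 2 < card T \<and> F \<inter> diagonals T = {} \<and>
           (\<forall>e\<in>diagonals T. \<forall>f\<in>F. \<not> interleaved e f)"
  using assms
proof (induction "card F" arbitrary: F S rule: less_induct)
  case less
  show ?case
  proof (cases "F = {}")
    case True
    then show ?thesis using less by auto
  next
    case False
    then obtain a b where ab: "(a, b) \<in> F" by auto
    define S1 S2 where "S1 = S \<inter> {a..b}" and "S2 = S - {a<..<b}"
    note * = diagonal_split[OF less.prems(1-3) ab, folded S1_def S2_def]
    have fin: "finite S1" "finite S2" using less.prems by (auto simp: S1_def S2_def)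
    \<comment> \<open>Common to both pieces \<open>R\<close>: the induction hypothesis controls only
      \<open>F \<inter> diagonals R\<close>, and \<open>sep\<close> handles the rest of
      \<open>F\<close>.\<close>
    have step: ?thesis
      if R: "R \<subseteq> S" "card (F \<inter> diagonals R) < card F"
        and big: "(card (F \<inter> diagonals R) + 1) * m + 2 < card R"
        and sep: "\<And>e f. f \<in> F - diagonals R \<Longrightarrow> e \<in> diagonals R \<Longrightarrow> \<not> interleaved e f"
      for R
    proof -
      have "finite R" using R less.prems finite_subset by auto
      moreover have "noncrossing (F \<inter> diagonals R)"
        using less.prems(3) by (rule noncrossing_subset) auto
      ultimately obtain T where T: "T \<subseteq> R" "m + 2 < card T" "F \<inter> diagonals R \<inter> diagonals T = {}"
        "\<forall>e\<in>diagonals T. \<forall>f\<in>F \<inter> diagonals R. \<not> interleaved e f"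
        using less.hyps[of "F \<inter> diagonals R" R] R big by auto
      then have "diagonals T \<subseteq> diagonals R" by (simp add: diagonals_mono)
      with T R sep have "T \<subseteq> S" "F \<inter> diagonals T = {}"
        "\<forall>e\<in>diagonals T. \<forall>f\<in>F. \<not> interleaved e f"
        by blast+
      with T(2) show ?thesis by blast
    qed
    have "((card (F \<inter> diagonals S1) + 1) * m + 2) + ((card (F \<inter> diagonals S2) + 1) * m + 2)
        = (card F + 1) * m + 4"
      using *(5) by (simp add: algebra_simps)
    then consider "(card (F \<inter> diagonals S1) + 1) * m + 2 < card S1"
      | "(card (F \<inter> diagonals S2) + 1) * m + 2 < card S2"
      using *(1) less.prems(4) by linarith
    then show ?thesis
    proof cases
      case 1
      show ?thesis
      proof (rule step[OF _ _ 1])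
        fix e f assume f: "f \<in> F - diagonals S1" and e: "e \<in> diagonals S1"
        then have "f = (a, b) \<or> f \<in> diagonals S2" using *(4) by blast
        then show "\<not> interleaved e f" using e
          by (cases e; cases f) (auto simp: diagonals_def chords_def S1_def S2_def)
      qed (use *(5) in \<open>auto simp: S1_def\<close>)
    next
      case 2
      show ?thesis
      proof (rule step[OF _ _ 2])
        fix e f assume f: "f \<in> F - diagonals S2" and e: "e \<in> diagonals S2"
        then have "f = (a, b) \<or> f \<in> diagonals S1" using *(4) by blast
        then show "\<not> interleaved e f" using e
          by (cases e; cases f) (auto simp: diagonals_def chords_def S1_def S2_def)
      qed (use *(5) in \<open>auto simp: S2_def\<close>)
    qed
  qed
qed

text \<open>With \<open>m = 2 * card I - 3\<close>, a violation yields a cell \<open>T\<close> with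
  at least \<open>2 * card I\<close> vertices, too many for the other colours to cover all its
  diagonals.\<close>

lemma saturated_colour_class_large:
  fixes S :: "'a::linorder set" and F :: "'c \<Rightarrow> ('a \<times> 'a) set"
  assumes "finite S" "finite I" "card I \<ge> 2"
    and F: "\<And>i. i \<in> I \<Longrightarrow> F i \<subseteq> diagonals S" "\<And>i. i \<in> I \<Longrightarrow> noncrossing (F i)"
    and sat: "\<And>e i. e \<in> diagonals S \<Longrightarrow> i \<in> I \<Longrightarrow> e \<notin> (\<Union>j\<in>I. F j) \<Longrightarrow> \<exists>f\<in>F i. interleaved e f"
    and i: "i \<in> I"
  shows "card S \<le> (card (F i) + 1) * (2 * card I - 3) + 2"
proof (rule ccontr)
  assume "\<not> ?thesis"
  then obtain T where T: "T \<subseteq> S" "2 * card I - 3 + 2 < card T" "F i \<inter> diagonals T = {}"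
    "\<forall>e\<in>diagonals T. \<forall>f\<in>F i. \<not> interleaved e f"
    using noncrossing_large_face[OF assms(1) F(1,2)[OF i], of "2 * card I - 3"] by auto
  have fT: "finite T" using T assms finite_subset by auto
  \<comment> \<open>The second bound makes \<open>card T - 3\<close> positive, so that this factor
    can be cancelled at the end.\<close>
  have big: "card T \<ge> 2 * card I" "card T \<ge> 4" using T assms by auto
  \<comment> \<open>Colour \<open>i\<close> neither contains nor blocks a diagonal of the cell, so
    by saturation another colour contains it.\<close>
  have "diagonals T \<subseteq> (\<Union>j\<in>I - {i}. F j \<inter> diagonals T)"
  proof
    fix e assume e: "e \<in> diagonals T"
    then have "e \<in> diagonals S" using diagonals_mono[OF T(1)] by blast
    then obtain j where "j \<in> I" "e \<in> F j" using sat[OF _ i, of e] T(4) e by blast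
    then show "e \<in> (\<Union>j\<in>I - {i}. F j \<inter> diagonals T)" using T(3) e by blast
  qed
  then have "card (diagonals T) \<le> card (\<Union>j\<in>I - {i}. F j \<inter> diagonals T)"
    using assms fT by (intro card_mono) (auto intro: finite_diagonals)
  also have "\<dots> \<le> (\<Sum>j\<in>I - {i}. card (F j \<inter> diagonals T))"
    using assms by (intro card_UN_le) auto
  also have "\<dots> \<le> (\<Sum>j\<in>I - {i}. card T - 3)"
  proof (rule sum_mono)
    fix j assume j: "j \<in> I - {i}"
    have "card (F j \<inter> diagonals T) + 3 \<le> card T"
      using j F(2)[of j] fT big by (intro card_noncrossing_diagonals_le) (auto intro: noncrossing_subset)
    then show "card (F j \<inter> diagonals T) \<le> card T - 3" by simp
  qed
  also have "\<dots> = (card I - 1) * (card T - 3)" using i by simp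
  finally have "card T * (card T - 3) \<le> 2 * (card I - 1) * (card T - 3)"
    using card_diagonals_ge[OF fT] by linarith
  then have "card T \<le> 2 * (card I - 1)" using big by simp
  then show False using big assms(3) by linarith
qed

section \<open>Points in convex position\<close>

text \<open>Twice the signed area of the triangle \<open>a b c\<close>, positive iff it is traversed
  counterclockwise.\<close>

definition orient :: "real ^ 2 \<Rightarrow> real ^ 2 \<Rightarrow> real ^ 2 \<Rightarrow> real" where
  "orient a b c = (b $ 1 - a $ 1) * (c $ 2 - a $ 2) - (b $ 2 - a $ 2) * (c $ 1 - a $ 1)"

lemma orient_rotate: "orient a b c = orient b c a"
  by (simp add: orient_def algebra_simps)

lemma orient_swap: "orient a c b = - orient a b c"
  by (simp add: orient_def algebra_simps)

lemma orient_degenerate [simp]: "orient a a c = 0" "orient a c a = 0" "orient c a a = 0"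
  by (simp_all add: orient_def algebra_simps)

lemma orient_affine:
  "orient a b ((1 - t) *\<^sub>R c + t *\<^sub>R d) = (1 - t) * orient a b c + t * orient a b d"
  by (simp add: orient_def algebra_simps)

text \<open>Either diagonal splits the quadrilateral \<open>a b c d\<close> into two triangles with
  the same total signed area.\<close>

lemma orient_sum: "orient b c d = orient a b c + orient a c d - orient a b d"
  by (simp add: orient_def algebra_simps)

text \<open>The affine dependence of four points in the plane: by \<open>orient_sum\<close> the
  coefficients on both sides have equal sums. It locates both intersections of diagonals and points
  inside triangles.\<close>

lemma orient_barycentric:
  "orient b c d *\<^sub>R a + orient a b d *\<^sub>R c = orient a c d *\<^sub>R b + orient a b c *\<^sub>R d"
  by (simp add: vec_eq_iff forall_2 orient_def algebra_simps)

lemma collinear_orient_zero: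
  assumes "orient a b c = 0"
  shows "collinear {a, b, c}"
proof (cases "b = a")
  case False
  have eq: "(b $ 1 - a $ 1) * (c $ 2 - a $ 2) = (b $ 2 - a $ 2) * (c $ 1 - a $ 1)"
    using assms by (simp add: orient_def)
  have "\<exists>t. c - a = t *\<^sub>R (b - a)"
  \<comment> \<open>The split selects a coordinate in which \<open>a\<close> and \<open>b\<close>
    differ, to divide by.\<close>
  proof (cases "b $ 1 = a $ 1")
    case True
    then have "b $ 2 \<noteq> a $ 2" using False by (auto simp: vec_eq_iff forall_2)
    moreover have "c $ 1 = a $ 1" using True eq \<open>b $ 2 \<noteq> a $ 2\<close> by simp
    ultimately have "c - a = ((c $ 2 - a $ 2) / (b $ 2 - a $ 2)) *\<^sub>R (b - a)"
      using True by (simp add: vec_eq_iff forall_2)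
    then show ?thesis ..
  next
    case ne: False
    then have "b $ 1 - a $ 1 \<noteq> 0" by simp
    with eq have "c $ 2 - a $ 2 = (c $ 1 - a $ 1) / (b $ 1 - a $ 1) * (b $ 2 - a $ 2)"
      by (simp add: nonzero_eq_divide_eq mult.commute)
    with ne have "c - a = ((c $ 1 - a $ 1) / (b $ 1 - a $ 1)) *\<^sub>R (b - a)"
      by (simp add: vec_eq_iff forall_2)
    then show ?thesis ..
  qed
  then have "collinear {0, b - a, c - a}" by (auto simp: collinear_lemma)
  then have "collinear {b, a, c}" by (subst collinear_3) auto
  then show ?thesis by (simp add: insert_commute)
qed auto

lemma convex_hull_3I:
  fixes a :: "'a::real_vector"
  assumes "u *\<^sub>R a = x *\<^sub>R b + y *\<^sub>R c + z *\<^sub>R d"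
    and "u = x + y + z" "x > 0" "y > 0" "z > 0"
  shows "a \<in> convex hull {b, c, d}"
proof -
  have "u > 0" using assms by simp
  have "a = (1 / u) *\<^sub>R (u *\<^sub>R a)" using \<open>u > 0\<close> by simp
  also have "\<dots> = (x / u) *\<^sub>R b + (y / u) *\<^sub>R c + (z / u) *\<^sub>R d"
    by (subst assms(1)) (simp add: scaleR_add_right)
  finally have "a = (x / u) *\<^sub>R b + (y / u) *\<^sub>R c + (z / u) *\<^sub>R d" .
  moreover have "x / u + y / u + z / u = 1" 
    using \<open>u > 0\<close> assms(2) by (simp add: add_divide_distrib[symmetric])
  moreover have "x / u \<ge> 0" "y / u \<ge> 0" "z / u \<ge> 0" using \<open>u > 0\<close> assms by auto
  ultimately show ?thesis unfolding convex_hull_3 by blast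
qed

lemma convex_positionD:
  assumes "convex_position S" "a \<in> S" "{b, c, d} \<subseteq> S - {a}"
  shows "a \<notin> convex hull {b, c, d}"
  using assms hull_mono[of "{b, c, d}" "S - {a}" convex] by (auto simp: convex_position_def)

section \<open>Enumerating points in hull order\<close>

text \<open>The number of predecessors is strictly monotone, hence a bijection onto an initial
  segment of the naturals; its inverse is the enumeration.\<close>

lemma finite_strict_order_enumeration:
  assumes "finite S"
    and irrefl: "\<And>x. x \<in> S \<Longrightarrow> \<not> R x x"
    and trans: "\<And>x y z. \<lbrakk>x \<in> S; y \<in> S; z \<in> S; R x y; R y z\<rbrakk> \<Longrightarrow> R x z"
    and total: "\<And>x y. \<lbrakk>x \<in> S; y \<in> S; x \<noteq> y\<rbrakk> \<Longrightarrow> R x y \<or> R y x"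
  shows "\<exists>h. bij_betw h {..<card S} S \<and> (\<forall>i j. i < j \<and> j < card S \<longrightarrow> R (h i) (h j))"
proof -
  define r where "r x = card {y \<in> S. R y x}" for x
  have mono: "r x < r y" if "x \<in> S" "y \<in> S" "R x y" for x y
    unfolding r_def
  proof (rule psubset_card_mono)
    show "{z \<in> S. R z x} \<subset> {z \<in> S. R z y}"
      using that irrefl trans by blast
  qed (use assms in auto)
  have inj: "inj_on r S"
    by (rule inj_onI) (metis mono total less_irrefl)
  have "r x < card S" if "x \<in> S" for x
    unfolding r_def using that irrefl assms(1) by (intro psubset_card_mono) auto
  then have "r ` S = {..<card S}"
    using inj by (intro card_subset_eq) (auto simp: card_image)
  then have bij: "bij_betw r S {..<card S}" using inj by (simp add: bij_betw_def)
  define h where "h = inv_into S r"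
  have h: "bij_betw h {..<card S} S" unfolding h_def by (rule bij_betw_inv_into[OF bij])
  have rh: "r (h i) = i" if "i < card S" for i
    unfolding h_def using bij that by (simp add: bij_betw_inv_into_right)
  have "R (h i) (h j)" if ij: "i < j" "j < card S" for i j
  proof -
    have hS: "h i \<in> S" "h j \<in> S" using h ij by (auto simp: bij_betw_def)
    have "h i \<noteq> h j" using rh[of i] rh[of j] ij by auto
    moreover have "\<not> R (h j) (h i)" using mono[of "h j" "h i"] hS rh[of i] rh[of j] ij by auto
    ultimately show ?thesis using total hS by blast
  qed
  with h show ?thesis by blast
qed

text \<open>Sort by angle around one point \<open>q\<close>. A failure of transitivity, or a wrongly
  oriented triple avoiding \<open>q\<close>, would put one of four points into the triangle of the
  other three.\<close>

lemma convex_position_enumeration: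
  assumes fin: "finite S" and gp: "general_position S" and cp: "convex_position S"
  shows "\<exists>h. bij_betw h {..<card S} S \<and>
           (\<forall>i j l. i < j \<and> j < l \<and> l < card S \<longrightarrow> orient (h i) (h j) (h l) > 0)"
proof (cases "S = {}")
  case False
  then obtain q where q: "q \<in> S" by blast
  have nz: "orient a b c \<noteq> 0" if "a \<in> S" "b \<in> S" "c \<in> S" "a \<noteq> b" "b \<noteq> c" "a \<noteq> c" for a b c
    using collinear_orient_zero[of a b c] gp that unfolding general_position_def by blast
  \<comment> \<open>the order of the other points by angle around \<open>q\<close>, preceded by \<open>q\<close> itself\<close>
  define R where "R x y \<longleftrightarrow> y \<noteq> q \<and> (x = q \<or> orient q x y > 0)" for x y
  have tr: "orient q x z > 0"
    if S: "x \<in> S" "y \<in> S" "z \<in> S" and o: "orient q x y > 0" "orient q y z > 0" for x y z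
  proof (rule ccontr)
    assume neg: "\<not> orient q x z > 0"
    have d: "x \<noteq> y" "y \<noteq> z" "x \<noteq> q" "y \<noteq> q" "z \<noteq> q" using o by auto
    moreover have "x \<noteq> z" using o orient_swap[of q x y] by auto
    ultimately have "orient q x z < 0" using neg nz[of q x z] S q by auto
    \<comment> \<open>The instantiation fills \<open>b\<close>, \<open>c\<close>, \<open>d\<close>,
      \<open>a\<close> in this order, so \<open>q\<close> plays the role of \<open>a\<close>. All
      three weights are positive, which puts \<open>q\<close> into the triangle
      \<open>x y z\<close>.\<close>
    moreover have eq: "orient x y z *\<^sub>R q
        = orient q y z *\<^sub>R x + (- orient q x z) *\<^sub>R y + orient q x y *\<^sub>R z"
      using orient_barycentric[of x y z q] by (simp add: algebra_simps)
    ultimately have "q \<in> convex hull {x, y, z}"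
      using o orient_sum[of x y z q] by (intro convex_hull_3I[OF eq]) auto
    then show False using convex_positionD[OF cp q] S d by blast
  qed
  have "\<exists>h. bij_betw h {..<card S} S \<and> (\<forall>i j. i < j \<and> j < card S \<longrightarrow> R (h i) (h j))"
  proof (rule finite_strict_order_enumeration[OF fin])
    show "R x z" if "x \<in> S" "y \<in> S" "z \<in> S" "R x y" "R y z" for x y z
      using that tr[of x y z] by (auto simp: R_def)
    show "R x y \<or> R y x" if "x \<in> S" "y \<in> S" "x \<noteq> y" for x y
    proof (cases "x = q \<or> y = q")
      case False
      then have "orient q x y \<noteq> 0" using nz that q by blast
      then show ?thesis using False orient_swap[of q x y] by (auto simp: R_def)
    qed (use that in \<open>auto simp: R_def\<close>)
  qed (auto simp: R_def)
  then obtain h where h: "bij_betw h {..<card S} S" "\<And>i j. i < j \<Longrightarrow> j < card S \<Longrightarrow> R (h i) (h j)"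
    by blast
  have "orient (h i) (h j) (h l) > 0" if ijl: "i < j" "j < l" "l < card S" for i j l
  proof -
    define x y z where "x = h i" and "y = h j" and "z = h l"
    have R: "R x y" "R y z" "R x z" using h(2) ijl by (auto simp: x_def y_def z_def)
    have S: "x \<in> S" "y \<in> S" "z \<in> S"
      using h(1) ijl by (auto simp: x_def y_def z_def bij_betw_def)
    have "orient x y z > 0"
    proof (cases "x = q")
      case True
      then show ?thesis using R by (auto simp: R_def)
    next
      case False
      then have o: "orient q x y > 0" "orient q y z > 0" "orient q x z > 0"
        using R by (auto simp: R_def)
      then have d: "x \<noteq> y" "y \<noteq> z" "x \<noteq> z" "x \<noteq> q" "y \<noteq> q" "z \<noteq> q" by auto
      show ?thesis
      proof (rule ccontr)
        \<comment> \<open>A clockwise turn at \<open>y\<close> would place \<open>y\<close> in the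
          triangle \<open>x z q\<close>.\<close>
        assume "\<not> ?thesis"
        then have "orient x y z < 0" using nz[of x y z] S d by auto
        moreover have eq: "orient q x z *\<^sub>R y
            = orient q y z *\<^sub>R x + orient q x y *\<^sub>R z + (- orient x y z) *\<^sub>R q"
          using orient_barycentric[of x y z q] by (simp add: algebra_simps)
        ultimately have "y \<in> convex hull {x, z, q}"
          using o orient_sum[of x y z q] by (intro convex_hull_3I[OF eq]) auto
        then show False using convex_positionD[OF cp S(2)] S q d by blast
      qed
    qed
    then show ?thesis by (simp add: x_def y_def z_def)
  qed
  with h(1) show ?thesis by blast
qed (auto simp: bij_betw_def)

section \<open>Crossing of segments read off from orientations\<close>

text \<open>Dividing \<open>orient_barycentric\<close> by the common coefficient sum
  \<open>s\<close> exhibits one point as a proper convex combination of \<open>a, c\<close> and of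
  \<open>b, d\<close>.\<close>

lemma open_segments_meet:
  assumes "orient a b c > 0" "orient a c d > 0" "orient a b d > 0" "orient b c d > 0"
  shows "open_segment a c \<inter> open_segment b d \<noteq> {}"
proof -
  define s where "s = orient b c d + orient a b d"
  have s: "s = orient a c d + orient a b c" by (simp add: s_def orient_sum[of b c d a])
  have "s > 0" using assms by (simp add: s_def)
  define t where "t = orient a b d / s"
  define u where "u = orient a b c / s"
  have "1 - t = (s - orient a b d) / s" "1 - u = (s - orient a b c) / s"
    using \<open>s > 0\<close> by (simp_all add: t_def u_def diff_divide_distrib)
  moreover have "s - orient a b d = orient b c d" "s - orient a b c = orient a c d"
    using s by (simp_all add: s_def)
  ultimately have 1: "1 - t = orient b c d / s" "1 - u = orient a c d / s"
    by simp_all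
  have "(1 - t) *\<^sub>R a + t *\<^sub>R c = (1 / s) *\<^sub>R (orient b c d *\<^sub>R a + orient a b d *\<^sub>R c)"
    unfolding 1 by (simp add: t_def scaleR_add_right)
  also have "\<dots> = (1 - u) *\<^sub>R b + u *\<^sub>R d"
    unfolding orient_barycentric 1 by (simp add: u_def scaleR_add_right)
  finally have eq: "(1 - t) *\<^sub>R a + t *\<^sub>R c = (1 - u) *\<^sub>R b + u *\<^sub>R d" .
  have "0 < t" "0 < u" "0 < 1 - t" "0 < 1 - u" unfolding 1 
    using assms \<open>s > 0\<close> by (simp_all add: t_def u_def)
  moreover have "a \<noteq> c" "b \<noteq> d" using assms by auto
  ultimately have "(1 - t) *\<^sub>R a + t *\<^sub>R c \<in> open_segment a c"
    "(1 - u) *\<^sub>R b + u *\<^sub>R d \<in> open_segment b d"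
    by (auto simp: in_segment)
  then show ?thesis using eq by auto
qed

text \<open>\<open>orient a b\<close> is affine, vanishes on the line \<open>a b\<close> and is
  positive on the open segment \<open>c d\<close>, since at most one of \<open>c\<close>,
  \<open>d\<close> lies on that line.\<close>

lemma open_segments_same_side:
  assumes "orient a b c \<ge> 0" "orient a b d \<ge> 0" "orient a b c + orient a b d > 0"
  shows "open_segment a b \<inter> open_segment c d = {}"
proof (rule ccontr)
  assume "\<not> ?thesis"
  then obtain t u where t: "0 < u" "u < 1"
    and eq: "(1 - t) *\<^sub>R a + t *\<^sub>R b = (1 - u) *\<^sub>R c + u *\<^sub>R d"
    by (auto simp: in_segment)
  have "(1 - u) * orient a b c + u * orient a b d = 0"
    using orient_affine[of a b t a b] orient_affine[of a b u c d] eq by simp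
  then have "(1 - u) * orient a b c = 0 \<and> u * orient a b d = 0"
    using assms t by (subst (asm) add_nonneg_eq_0_iff) auto
  then show False using assms t by auto
qed

text \<open>The relative interior of a nondegenerate closed segment is the open segment.\<close>

lemma crosses_edge:
  assumes "p u \<noteq> p v" "p x \<noteq> p y"
  shows "crosses p {u, v} {x, y} \<longleftrightarrow> open_segment (p u) (p v) \<inter> open_segment (p x) (p y) \<noteq> {}"
  using assms
  by (simp add: crosses_def edge_segment_def rel_interior_closed_segment flip: segment_convex_hull)

section \<open>Saturated convex drawings\<close>

fun chord_edge :: "(nat \<Rightarrow> 'a) \<Rightarrow> nat \<times> nat \<Rightarrow> 'a set" where
  "chord_edge h (a, b) = {h a, h b}"

lemma inj_on_chord_edge:
  assumes "inj_on h S"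
  shows "inj_on (chord_edge h) (chords S)"
proof (rule inj_onI, clarify)
  fix a b c d
  assume *: "(a, b) \<in> chords S" "(c, d) \<in> chords S" "chord_edge h (a, b) = chord_edge h (c, d)"
  then have S: "a \<in> S" "b \<in> S" "c \<in> S" "d \<in> S" "a < b" "c < d"
    by (auto simp: chords_def)
  from * have "h a = h c \<and> h b = h d \<or> h a = h d \<and> h b = h c"
    by (simp add: doubleton_eq_iff)
  then have "a = c \<and> b = d \<or> a = d \<and> b = c"
    using S inj_onD[OF assms] by metis
  then show "a = c \<and> b = d" using S by auto
qed

lemma crosses_sym: "crosses p e f \<longleftrightarrow> crosses p f e"
  by (auto simp: crosses_def)

text \<open>The hull enumeration is pulled back along \<open>p\<close>. The condition
  \<open>e \<noteq> f\<close> matters: an edge meets itself, while \<open>interleaved\<close> is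
  irreflexive.\<close>

lemma convex_drawing_enumeration:
  assumes "straight_line_drawing V E p" "convex_position (p ` V)"
  shows "\<exists>h. bij_betw h {..<card V} V \<and>
    (\<forall>e\<in>chords {..<card V}. \<forall>f\<in>chords {..<card V}. e \<noteq> f \<longrightarrow>
       (crosses p (chord_edge h e) (chord_edge h f) \<longleftrightarrow> interleaved e f))"
proof -
  have inj: "inj_on p V" and fin: "finite V" and gp: "general_position (p ` V)"
    using assms by (auto simp: straight_line_drawing_def simple_graph_def)
  obtain q where q: "bij_betw q {..<card V} (p ` V)"
    and o: "\<And>i j l. i < j \<Longrightarrow> j < l \<Longrightarrow> l < card V \<Longrightarrow> orient (q i) (q j) (q l) > 0"
    using convex_position_enumeration[OF _ gp assms(2)] fin card_image[OF inj] by auto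
  define h where "h = inv_into V p \<circ> q"
  have "bij_betw (inv_into V p) (p ` V) V"
    using inj by (intro bij_betw_inv_into) (simp add: bij_betw_def)
  then have h: "bij_betw h {..<card V} V" unfolding h_def using q by (rule bij_betw_trans[rotated])
  have ph: "p (h i) = q i" if "i < card V" for i
    using f_inv_into_f[of "q i" p V] q that by (auto simp: h_def bij_betw_def)
  have ne: "q i \<noteq> q j" if "i < j" "j < card V" for i j
    using q that by (auto simp: bij_betw_def inj_on_def)
  \<comment> \<open>Labels between \<open>a\<close> and \<open>b\<close> lie to the right of the
    directed line from \<open>q a\<close> to \<open>q b\<close>, all others to the left.\<close>
  have inner: "orient (q a) (q b) (q x) \<le> 0" "x \<noteq> a \<Longrightarrow> x \<noteq> b \<Longrightarrow> orient (q a) (q b) (q x) < 0"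
    if "a < b" "b < card V" "a \<le> x" "x \<le> b" for a b x
    using that o[of a x b] orient_swap[of "q a" "q x" "q b"] by (cases "x = a"; cases "x = b"; simp)+
  have outer: "orient (q a) (q b) (q x) \<ge> 0" "x \<noteq> a \<Longrightarrow> x \<noteq> b \<Longrightarrow> orient (q a) (q b) (q x) > 0"
    if "a < b" "b < card V" "x < card V" "x \<le> a \<or> b \<le> x" for a b x
    using that o[of x a b] o[of a b x] orient_rotate[of "q x" "q a" "q b"]
    by (cases "x = a"; cases "x = b"; force)+
  have "open_segment (q a) (q b) \<inter> open_segment (q c) (q d) \<noteq> {} \<longleftrightarrow> interleaved (a, b) (c, d)"
    if ab: "a < b" "b < card V" and cd: "c < d" "d < card V" and "(a, b) \<noteq> (c, d)" for a b c d
  proof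
    assume "interleaved (a, b) (c, d)"
    then consider "a < c" "c < b" "b < d" | "c < a" "a < d" "d < b" by auto
    then show "open_segment (q a) (q b) \<inter> open_segment (q c) (q d) \<noteq> {}"
    proof cases
      case 1
      then show ?thesis using cd by (intro open_segments_meet o) auto
    next
      case 2
      then have "open_segment (q c) (q d) \<inter> open_segment (q a) (q b) \<noteq> {}"
        using ab by (intro open_segments_meet o) auto
      then show ?thesis by (simp add: Int_commute)
    qed
  next
    assume meet: "open_segment (q a) (q b) \<inter> open_segment (q c) (q d) \<noteq> {}"
    show "interleaved (a, b) (c, d)"
    proof (rule ccontr)
      assume ni: "\<not> interleaved (a, b) (c, d)"
      have cases: "c \<noteq> a \<and> c \<noteq> b \<or> d \<noteq> a \<and> d \<noteq> b" using that by auto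
      \<comment> \<open>Without interleaving, both ends of \<open>(c, d)\<close> lie on the same
        closed arc; by \<open>cases\<close> one of them is off the line.\<close>
      consider "a \<le> c" "c \<le> b" "a \<le> d" "d \<le> b" | "c \<le> a \<or> b \<le> c" "d \<le> a \<or> b \<le> d"
        using ni ab cd by fastforce
      then show False
      proof cases
        case 1
        note c = inner[OF ab 1(1,2)] and d = inner[OF ab 1(3,4)]
        have "orient (q b) (q a) (q x) = - orient (q a) (q b) (q x)" for x
          using orient_rotate[of "q b" "q a" "q x"] orient_swap[of "q a" "q b" "q x"] by simp
        then have "open_segment (q b) (q a) \<inter> open_segment (q c) (q d) = {}"
          using c d cases by (intro open_segments_same_side) auto
        then show False using meet by (simp add: open_segment_commute)
      next
        case 2
        have "c < card V" using cd by simp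
        note c = outer[OF ab this 2(1)] and d = outer[OF ab cd(2) 2(2)]
        have "open_segment (q a) (q b) \<inter> open_segment (q c) (q d) = {}"
          using c d cases by (intro open_segments_same_side) auto
        then show False using meet by simp
      qed
    qed
  qed
  then have "crosses p {h a, h b} {h c, h d} \<longleftrightarrow> interleaved (a, b) (c, d)"
    if "a < b" "b < card V" "c < d" "d < card V" "(a, b) \<noteq> (c, d)" for a b c d
    using that ne by (subst crosses_edge) (simp_all add: ph)
  then have "\<forall>e\<in>chords {..<card V}. \<forall>f\<in>chords {..<card V}. e \<noteq> f \<longrightarrow>
       (crosses p (chord_edge h e) (chord_edge h f) \<longleftrightarrow> interleaved e f)"
    by (auto simp: chords_def simp del: interleaved.simps)
  with h show ?thesis by blast
qed

text \<open>Adding \<open>{u, v}\<close> in colour \<open>i\<close> must create a monochromatic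
  crossing; old edges keep their colours, so the new edge takes part in it.\<close>

lemma saturated_blocking_edge:
  assumes "saturated k V E p \<phi>" "u \<in> V" "v \<in> V" "u \<noteq> v" "{u, v} \<notin> E" "i \<in> {1..k}"
  shows "\<exists>f\<in>E. \<phi> f = i \<and> crosses p {u, v} f"
proof -
  define \<psi> where "\<psi> = \<phi>({u, v} := i)"
  have d: "straight_line_drawing V E p" and col: "theta_coloring k E p \<phi>"
    using assms(1) by (auto simp: saturated_def precolored_theta_drawing_def theta_drawing_def)
  have "straight_line_drawing V (insert {u, v} E) p"
    using d assms(2-4) by (auto simp: straight_line_drawing_def simple_graph_def)
  moreover have "\<not> precolored_theta_drawing k V (insert {u, v} E) p \<psi>"
    using assms unfolding saturated_def \<psi>_def by blast
  ultimately have "\<not> theta_coloring k (insert {u, v} E) p \<psi>"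
    by (auto simp: precolored_theta_drawing_def theta_drawing_def)
  moreover have "\<psi> ` insert {u, v} E \<subseteq> {1..k}"
    using col assms(6) by (auto simp: theta_coloring_def \<psi>_def)
  ultimately obtain e f where ef: "e \<in> insert {u, v} E" "f \<in> insert {u, v} E" "e \<noteq> f"
    "\<psi> e = \<psi> f" "crosses p e f"
    unfolding theta_coloring_def by blast
  have \<psi>: "\<psi> {u, v} = i" "\<And>e. e \<in> E \<Longrightarrow> \<psi> e = \<phi> e"
    using assms(5) by (auto simp: \<psi>_def)
  have "\<not> (e \<in> E \<and> f \<in> E)"
    using ef \<psi>(2) col unfolding theta_coloring_def by metis
  then consider "e = {u, v}" "f \<in> E" | "f = {u, v}" "e \<in> E" using ef by blast
  then show ?thesis
  proof cases
    case 1
    then show ?thesis using ef \<psi> by (metis)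
  next
    case 2
    then show ?thesis using ef \<psi> crosses_sym by metis
  qed
qed

text \<open>Here \<open>m i\<close> counts the diagonals of colour \<open>i\<close>. For
  \<open>k = 1\<close> the truncated \<open>2 * k - 3\<close> would be zero and the second bound
  false.\<close>

lemma saturated_convex_card_edges:
  fixes V :: "'a set"
  assumes sat: "saturated_convex k V E p \<phi>" and k: "k \<ge> 1" and n: "card V \<ge> 3"
  obtains m where "card E \<ge> card V + (\<Sum>i\<in>{1..k}. m i)"
    and "k \<ge> 2 \<Longrightarrow> \<forall>i\<in>{1..k}. card V \<le> (m i + 1) * (2 * k - 3) + 2"
proof -
  define N where "N = {..<card V}"
  have d: "straight_line_drawing V E p" and col: "theta_coloring k E p \<phi>"
    and cp: "convex_position (p ` V)" and s: "saturated k V E p \<phi>"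
    using sat by (auto simp: saturated_convex_def saturated_def precolored_theta_drawing_def
        theta_drawing_def)
  obtain h where h: "bij_betw h N V"
    and cr: "\<And>e f. e \<in> chords N \<Longrightarrow> f \<in> chords N \<Longrightarrow> e \<noteq> f \<Longrightarrow>
       crosses p (chord_edge h e) (chord_edge h f) \<longleftrightarrow> interleaved e f"
    using convex_drawing_enumeration[OF d cp] unfolding N_def by blast
  have inj: "inj_on (chord_edge h) (chords N)"
    using h by (intro inj_on_chord_edge) (simp add: bij_betw_def)
  have EV: "finite V" "\<And>e. e \<in> E \<Longrightarrow> e \<subseteq> V \<and> card e = 2"
    using d by (auto simp: straight_line_drawing_def simple_graph_def)
  then have finE: "finite E" by (intro finite_subset[of E "Pow V"]) auto
  have edge_chord: "\<exists>f\<in>chords N. e = chord_edge h f" if e: "e \<in> E" for e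
  proof -
    obtain u v where uv: "e = {u, v}" "u \<noteq> v" "u \<in> V" "v \<in> V"
      using EV(2)[OF e] by (auto simp: card_2_iff)
    then obtain i j where ij: "u = h i" "v = h j" "i \<in> N" "j \<in> N" "i \<noteq> j"
      using h by (auto simp: bij_betw_def)
    then consider "i < j" | "j < i" by linarith
    then show ?thesis
    proof cases
      case 1
      then show ?thesis using uv ij by (intro bexI[of _ "(i, j)"]) (auto simp: chords_def)
    next
      case 2
      then show ?thesis using uv ij by (intro bexI[of _ "(j, i)"]) (auto simp: chords_def)
    qed
  qed
  have block: "\<exists>f\<in>chords N. chord_edge h f \<in> E \<and> \<phi> (chord_edge h f) = i \<and> interleaved e f"
    if e: "e \<in> chords N" "chord_edge h e \<notin> E" "i \<in> {1..k}" for e i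
  proof -
    obtain a b where ab: "e = (a, b)" "a \<in> N" "b \<in> N" "a < b"
      using e(1) by (auto simp: chords_def)
    have "h a \<in> V" "h b \<in> V" "h a \<noteq> h b"
      using h ab by (auto simp: bij_betw_def inj_on_def)
    then obtain f where f: "f \<in> E" "\<phi> f = i" "crosses p (chord_edge h e) f"
      using saturated_blocking_edge[OF s, of "h a" "h b" i] e ab by auto
    obtain f' where f': "f' \<in> chords N" "f = chord_edge h f'" using edge_chord[OF f(1)] by blast
    then have "e \<noteq> f'" using e f by auto
    then show ?thesis using f f' cr[OF e(1) f'(1)] by blast
  qed
  \<comment> \<open>Sides are left out whatever their colour, as they are counted separately in
    \<open>B\<close>.\<close>
  define F where "F i = {f \<in> diagonals N. chord_edge h f \<in> E \<and> \<phi> (chord_edge h f) = i}" for i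
  have dc: "diagonals N \<subseteq> chords N" by (auto simp: diagonals_def)
  have finN: "finite N" by (simp add: N_def)
  have finF: "finite (F i)" for i
    using finite_diagonals[OF finN] by (simp add: F_def)
  have nc: "noncrossing (F i)" for i
    unfolding noncrossing_def
  proof (intro ballI notI)
    fix e f assume ef: "e \<in> F i" "f \<in> F i" "interleaved e f"
    then have c: "e \<in> chords N" "f \<in> chords N" using dc by (auto simp: F_def)
    have "e \<noteq> f" using ef(3) by (cases e) auto
    then have "chord_edge h e \<noteq> chord_edge h f" "crosses p (chord_edge h e) (chord_edge h f)"
      using inj c ef(3) cr by (auto dest: inj_onD)
    then show False using ef col unfolding theta_coloring_def F_def by auto
  qed
  have large: "card V \<le> (card (F i) + 1) * (2 * k - 3) + 2" if "k \<ge> 2" "i \<in> {1..k}" for i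
  proof -
    have "card N \<le> (card (F i) + 1) * (2 * card {1..k} - 3) + 2"
    proof (rule saturated_colour_class_large[where F = F, OF finN _ _ _ nc _ that(2)])
      fix e j assume e: "e \<in> diagonals N" "j \<in> {1..k}" "e \<notin> (\<Union>j\<in>{1..k}. F j)"
      have "chord_edge h e \<notin> E"
        using e(1,3) col by (auto simp: F_def theta_coloring_def)
      with block[of e j] e dc obtain f where f: "f \<in> chords N" "chord_edge h f \<in> E"
        "\<phi> (chord_edge h f) = j" "interleaved e f" by blast
      \<comment> \<open>A blocking chord interleaves with \<open>e\<close>, so it is itself a
        diagonal.\<close>
      then have "f \<in> F j"
        using interleaved_chords_diagonals(2)[of e N f] e dc by (auto simp: F_def)
      with f show "\<exists>f\<in>F j. interleaved e f" by blast
    qed (use that in \<open>auto simp: F_def\<close>)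
    then show ?thesis by (simp add: N_def)
  qed
  define B where "B = chords N - diagonals N"
  \<comment> \<open>A missing side would need a blocking edge in colour 1, but sides interleave with
    nothing.\<close>
  have BE: "chord_edge h e \<in> E" if "e \<in> B" for e
  proof (rule ccontr)
    assume "chord_edge h e \<notin> E"
    moreover have e: "e \<in> chords N" "e \<notin> diagonals N" using that by (auto simp: B_def)
    moreover have "1 \<in> {1..k}" using k by simp
    ultimately obtain f where "f \<in> chords N" "interleaved e f" using block by blast
    then show False using interleaved_chords_diagonals(1) e by blast
  qed
  have "card B + card (\<Union>i\<in>{1..k}. F i) = card (B \<union> (\<Union>i\<in>{1..k}. F i))"
    using finF finN by (intro card_Un_disjoint[symmetric]) (auto simp: B_def F_def finite_chords)
  also have "\<dots> \<le> card E"
    using BE finE dc inj_on_subset[OF inj, of "B \<union> (\<Union>i\<in>{1..k}. F i)"]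
    by (intro card_inj_on_le[of "chord_edge h"]) (auto simp: B_def F_def)
  also have "card (\<Union>i\<in>{1..k}. F i) = (\<Sum>i\<in>{1..k}. card (F i))"
    using finF by (intro card_UN_disjoint) (auto simp: F_def)
  finally have "card B + (\<Sum>i\<in>{1..k}. card (F i)) \<le> card E" .
  moreover have "card V \<le> card B"
    using card_boundary_chords_lessThan[OF n] by (simp add: B_def N_def)
  ultimately have "card V + (\<Sum>i\<in>{1..k}. card (F i)) \<le> card E" by simp
  then show thesis using large by (intro that[of "\<lambda>i. card (F i)"]) auto
qed

theorem theorem2p5:
  fixes k n :: nat and V :: "'a set" and E :: "'a set set"
    and p :: "'a \<Rightarrow> real ^ 2" and \<phi> :: "'a set \<Rightarrow> nat"
  assumes "k \<ge> 1" and "n \<ge> 3" and "n \<ge> 2 * k - 1"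
    and "min_saturated k V E p \<phi>" and "card V = n"
  shows "real (card E) \<ge> real k * (real n - 2 * real k + 1) / (2 * real k - 3) + real n"
proof -
  have "saturated_convex k V E p \<phi>" using assms(4) by (simp add: min_saturated_def)
  then obtain m where m: "card E \<ge> n + (\<Sum>i\<in>{1..k}. m i)"
    "k \<ge> 2 \<Longrightarrow> \<forall>i\<in>{1..k}. n \<le> (m i + 1) * (2 * k - 3) + 2"
    using saturated_convex_card_edges[of k V E p \<phi>] assms by metis
  show ?thesis
  proof (cases "k = 1")
    \<comment> \<open>For \<open>k = 1\<close> the denominator is \<open>-1\<close> and the bound
      collapses to 1.\<close>
    case True
    then show ?thesis using m(1) assms(2) by simp
  next
    case False
    then have k: "k \<ge> 2" using assms(1) by simp
    \<comment> \<open>The share of one colour, equal to \<open>(n - 2) / (2 * k - 3) - 1\<close>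
      over the reals.\<close>
    define c where "c = (real n - 2 * real k + 1) / (2 * real k - 3)"
    have "c \<le> real (m i)" if "i \<in> {1..k}" for i
    proof -
      have "n \<le> (m i + 1) * (2 * k - 3) + 2" using m(2) k that by blast
      then have "real n \<le> real ((m i + 1) * (2 * k - 3) + 2)" by (rule of_nat_mono)
      moreover have "real (2 * k - 3) = 2 * real k - 3" using k by (subst of_nat_diff) auto
      then have "real ((m i + 1) * (2 * k - 3) + 2) = (real (m i) + 1) * (2 * real k - 3) + 2"
        by (simp only: of_nat_add of_nat_mult) simp
      ultimately have "real n \<le> (real (m i) + 1) * (2 * real k - 3) + 2" by simp
      then show ?thesis using k by (simp add: c_def divide_le_eq algebra_simps)
    qed
    then have "real k * c \<le> (\<Sum>i\<in>{1..k}. real (m i))"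
      using sum_bounded_below[of "{1..k}" c "\<lambda>i. real (m i)"] by simp
    also have "\<dots> \<le> real (card E) - real n"
      using m(1) by (simp flip: of_nat_sum of_nat_add add: le_diff_eq)
    finally show ?thesis by (simp add: c_def)
  qed
qed

end
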